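(* Let $m\geq 2$. The folded halved $2m$-cube admits instantaneous uniform mixing (at some time $\tau$) if and only if $m$ is even.
   Context: The halved $2m$-cube has as vertices the binary words of length $2m$ of even weight, adjacent when they differ in exactly two coordinates; it is antipodal with antipodal classes $\{a,a\oplus\mathbf{1}\}$. The folded halved $2m$-cube is the quotient graph obtained by identifying each $a$ with $a\oplus\mathbf{1}$ (two classes adjacent when some representatives are adjacent in the halved $2m$-cube); it is a distance-regular graph on $2^{2m-2}$ vertices. For a graph $X$ with adjacency matrix $A(X)$, the continuous-time quantum walk is instantaneous uniform mixing at time $\tau$ if $|e^{-i\tau A(X)}_{a,b}|=1/\sqrt{|V(X)|}$ for all vertices $a,b$; $X$ admits instantaneous uniform mixing if this holds for some real $\tau$. *)

theory Defs
  imports "HOL-Analysis.Analysis" "Graph_Theory.Pair_Digraph"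
begin

section \<open>Matrices indexed by a finite set\<close>

text \<open>
  A square matrix with rows and columns indexed by a finite set \<open>V\<close> is a function of two
  arguments; only its values on \<open>V \<times> V\<close> are meaningful.
\<close>

fun matrix_pow :: "'v set \<Rightarrow> ('v \<Rightarrow> 'v \<Rightarrow> complex) \<Rightarrow> nat \<Rightarrow> 'v \<Rightarrow> 'v \<Rightarrow> complex" where
  "matrix_pow V M 0 a b = (if a = b then 1 else 0)"
| "matrix_pow V M (Suc k) a b = (\<Sum>v\<in>V. M a v * matrix_pow V M k v b)"

definition matrix_exp :: "'v set \<Rightarrow> ('v \<Rightarrow> 'v \<Rightarrow> complex) \<Rightarrow> 'v \<Rightarrow> 'v \<Rightarrow> complex" where
  "matrix_exp V M a b = (\<Sum>k. matrix_pow V M k a b /\<^sub>R fact k)"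

lemma norm_matrix_pow_le:
  assumes "finite V" "a \<in> V"
  shows "norm (matrix_pow V M k a b) \<le> (\<Sum>u\<in>V. \<Sum>v\<in>V. norm (M u v)) ^ k"
  using assms(2)
proof (induction k arbitrary: a)
  case 0
  then show ?case by simp
next
  case (Suc k)
  let ?C = "\<Sum>u\<in>V. \<Sum>v\<in>V. norm (M u v)"
  have nonneg: "0 \<le> ?C" by (simp add: sum_nonneg)
  have "norm (matrix_pow V M (Suc k) a b) \<le> (\<Sum>v\<in>V. norm (M a v) * norm (matrix_pow V M k v b))"
    using norm_sum[of "\<lambda>v. M a v * matrix_pow V M k v b" V] by (simp add: norm_mult)
  also have "\<dots> \<le> (\<Sum>v\<in>V. norm (M a v) * ?C ^ k)"
    by (intro sum_mono mult_left_mono Suc.IH) auto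
  also have "\<dots> = (\<Sum>v\<in>V. norm (M a v)) * ?C ^ k"
    by (simp add: sum_distrib_right)
  also have "\<dots> \<le> ?C * ?C ^ k"
    using member_le_sum[of a V "\<lambda>u. \<Sum>v\<in>V. norm (M u v)"] Suc.prems assms(1) nonneg
    by (intro mult_right_mono) (auto simp: sum_nonneg)
  finally show ?case by simp
qed

lemma summable_matrix_exp:
  assumes "finite V" "a \<in> V"
  shows "summable (\<lambda>k. matrix_pow V M k a b /\<^sub>R fact k)"
proof (rule summable_comparison_test)
  let ?C = "\<Sum>u\<in>V. \<Sum>v\<in>V. norm (M u v)"
  show "summable (\<lambda>k. ?C ^ k /\<^sub>R fact k)"
    by (rule summable_exp_generic)
  have "norm (matrix_pow V M k a b /\<^sub>R fact k) \<le> ?C ^ k /\<^sub>R fact k" for k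
    using norm_matrix_pow_le[OF assms, of M k b] by (simp add: mult_left_mono)
  then show "\<exists>N. \<forall>k\<ge>N. norm (matrix_pow V M k a b /\<^sub>R fact k) \<le> ?C ^ k /\<^sub>R fact k"
    by blast
qed

section \<open>Instantaneous uniform mixing\<close>

definition adjacency_matrix :: "'v pair_pre_digraph \<Rightarrow> 'v \<Rightarrow> 'v \<Rightarrow> complex" where
  "adjacency_matrix X a b = (if (a, b) \<in> parcs X then 1 else 0)"

definition walk_matrix :: "'v pair_pre_digraph \<Rightarrow> real \<Rightarrow> 'v \<Rightarrow> 'v \<Rightarrow> complex" where
  "walk_matrix X \<tau> = matrix_exp (pverts X) (\<lambda>a b. - \<i> * of_real \<tau> * adjacency_matrix X a b)"

definition uniform_mixing_at :: "'v pair_pre_digraph \<Rightarrow> real \<Rightarrow> bool" where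
  "uniform_mixing_at X \<tau> \<longleftrightarrow>
    (\<forall>a\<in>pverts X. \<forall>b\<in>pverts X. norm (walk_matrix X \<tau> a b) = 1 / sqrt (real (card (pverts X))))"

definition admits_uniform_mixing :: "'v pair_pre_digraph \<Rightarrow> bool" where
  "admits_uniform_mixing X \<longleftrightarrow> (\<exists>\<tau>. uniform_mixing_at X \<tau>)"

section \<open>The folded halved cube\<close>

definition halved_cube :: "nat \<Rightarrow> bool list pair_pre_digraph" where
  "halved_cube n = (let V = {a. length a = n \<and> even (count_list a True)} in
    \<lparr>pverts = V,
     parcs = {(a, b). a \<in> V \<and> b \<in> V \<and> card {i. i < n \<and> a ! i \<noteq> b ! i} = 2}\<rparr>)"

definition antipodal_rel :: "nat \<Rightarrow> bool list rel" where
  "antipodal_rel n =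
    {(a, b). a \<in> pverts (halved_cube n) \<and> b \<in> pverts (halved_cube n) \<and> (b = a \<or> b = map Not a)}"

definition quotient_graph :: "'v pair_pre_digraph \<Rightarrow> 'v rel \<Rightarrow> 'v set pair_pre_digraph" where
  "quotient_graph X r =
    \<lparr>pverts = pverts X // r,
     parcs = {(S, T). S \<in> pverts X // r \<and> T \<in> pverts X // r \<and> (\<exists>a\<in>S. \<exists>b\<in>T. (a, b) \<in> parcs X)}\<rparr>"

definition folded_halved_cube :: "nat \<Rightarrow> bool list set pair_pre_digraph" where
  "folded_halved_cube m = quotient_graph (halved_cube (2 * m)) (antipodal_rel (2 * m))"

lemma equiv_antipodal_rel: "equiv (pverts (halved_cube n)) (antipodal_rel n)"
proof (rule equivI)
  show "antipodal_rel n \<subseteq> pverts (halved_cube n) \<times> pverts (halved_cube n)"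
    and "refl_on (pverts (halved_cube n)) (antipodal_rel n)"
    by (auto simp: antipodal_rel_def refl_on_def)
  have Not_Not: "map Not (map Not a) = a" for a
    by (simp add: comp_def)
  show "sym (antipodal_rel n)"
    unfolding antipodal_rel_def sym_def mem_Collect_eq prod.case using Not_Not by metis
  show "trans (antipodal_rel n)"
    unfolding antipodal_rel_def trans_def mem_Collect_eq prod.case using Not_Not by metis
qed

text \<open>
  Loop-freeness needs \<open>m \<ge> 2\<close>: for \<open>m = 1\<close> antipodal words are adjacent.
\<close>

lemma pair_graph_folded_halved_cube:
  assumes "m \<ge> 2"
  shows "pair_graph (folded_halved_cube m)"
proof -
  let ?H = "halved_cube (2 * m)" and ?r = "antipodal_rel (2 * m)"
  have finV: "finite (pverts ?H)"
    by (rule finite_subset[OF _ finite_lists_length_eq[of "UNIV :: bool set" "2 * m"]])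
      (auto simp: halved_cube_def Let_def)
  have finQ: "finite (pverts ?H // ?r)"
    by (rule finite_quotient[OF finV]) (auto simp: antipodal_rel_def)
  have sym: "(b, a) \<in> parcs ?H" if "(a, b) \<in> parcs ?H" for a b
  proof -
    have "{i. i < 2 * m \<and> b ! i \<noteq> a ! i} = {i. i < 2 * m \<and> a ! i \<noteq> b ! i}" by auto
    with that show ?thesis unfolding halved_cube_def Let_def by simp
  qed
  have irr: "(a, b) \<notin> parcs ?H" if "(a, b) \<in> ?r" for a b
  proof
    assume ab: "(a, b) \<in> parcs ?H"
    from that consider "b = a" | "b = map Not a" by (auto simp: antipodal_rel_def)
    then show False
    proof cases
      case 1
      with ab show False by (simp add: halved_cube_def Let_def)
    next
      case 2
      have "length a = 2 * m" using ab by (simp add: halved_cube_def Let_def)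
      then have "{i. i < 2 * m \<and> a ! i \<noteq> b ! i} = {..<2 * m}"
        using 2 by auto
      with ab have "card {..<2 * m} = 2"
        by (simp add: halved_cube_def Let_def)
      with assms show False by simp
    qed
  qed
  have loopfree: "S \<noteq> T" if "(S, T) \<in> parcs (folded_halved_cube m)" for S T
  proof
    assume "S = T"
    with that obtain a b where "S \<in> pverts ?H // ?r" "a \<in> S" "b \<in> S" "(a, b) \<in> parcs ?H"
      by (auto simp: folded_halved_cube_def quotient_graph_def)
    with irr quotient_eq_iff[OF equiv_antipodal_rel, of S "2 * m" S a b] show False by blast
  qed
  have sym_folded: "(T, S) \<in> parcs (folded_halved_cube m)"
    if "(S, T) \<in> parcs (folded_halved_cube m)" for S T
    using that sym unfolding folded_halved_cube_def quotient_graph_def by auto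
  show ?thesis
  proof
    show "finite (parcs (folded_halved_cube m))"
      by (rule finite_subset[OF _ finite_cartesian_product[OF finQ finQ]])
        (auto simp: folded_halved_cube_def quotient_graph_def)
    show "symmetric (with_proj (folded_halved_cube m))"
      using sym_folded unfolding symmetric_def by (auto intro: symI)
  next
    fix e assume "e \<in> parcs (folded_halved_cube m)"
    then show "fst e \<noteq> snd e" using loopfree by (cases e) simp
  qed (use finQ in \<open>auto simp: folded_halved_cube_def quotient_graph_def\<close>)
qed

end

(*
  Identifying a word with its support and using the characters S |-> (-1)^|S Int B| of the even
  subsets, the walk at time tau is the Fourier transform of g(S) = exp(-i tau theta(|S|)), where
  theta(k) = 2(m-k)^2 - m (halved for m = 2).  Uniform mixing means that this transform is flat.

  For even m the time tau = pi/8 (pi/4 for m = 2) turns g(S) into a constant multiple of i^|S|,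
  whose transform is a product of factors 1 + i and 1 - i.

  A flat transform forces all nontrivial autocorrelations of g to vanish.  For odd m the
  autocorrelation at a two-element set R is nevertheless positive: the sets S meeting R in one
  element contribute 1 each, and the others contribute
  (2 cos 4tau)^(2m-2) + (2i sin 4tau)^(2m-2), which is nonnegative as m - 1 is even.
*)
theory Submission
  imports Defs
begin

section \<open>Spectral decomposition of a matrix exponential\<close>

text \<open>The families \<open>e\<close> and \<open>f\<close> resolve the identity, and each
  \<open>e s\<close> is an eigenvector. Applying \<open>M\<close> repeatedly to this resolution
  multiplies the \<open>s\<close>-th term by \<open>\<theta> s\<close> each time, so the exponential
  series can be summed separately for every \<open>s\<close>.\<close>

lemma matrix_exp_spectral:
  assumes resolution: "\<And>a b. a \<in> V \<Longrightarrow> b \<in> V \<Longrightarrow> (\<Sum>s\<in>I. e s a * f s b) = (if a = b then 1 else 0)"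
    and eigen: "\<And>s a. s \<in> I \<Longrightarrow> a \<in> V \<Longrightarrow> (\<Sum>v\<in>V. M a v * e s v) = \<theta> s * e s a"
    and "a \<in> V" "b \<in> V"
  shows "matrix_exp V M a b = (\<Sum>s\<in>I. exp (\<theta> s) * (e s a * f s b))"
proof -
  have pow: "matrix_pow V M k a b = (\<Sum>s\<in>I. \<theta> s ^ k * (e s a * f s b))" if "a \<in> V" for k a
    using that
  proof (induction k arbitrary: a)
    case 0
    then show ?case using resolution[OF 0 assms(4)] by simp
  next
    case (Suc k)
    have "matrix_pow V M (Suc k) a b = (\<Sum>v\<in>V. \<Sum>s\<in>I. M a v * e s v * (\<theta> s ^ k * f s b))"
      by (simp add: Suc.IH sum_distrib_left mult_ac)
    also have "\<dots> = (\<Sum>s\<in>I. (\<Sum>v\<in>V. M a v * e s v) * (\<theta> s ^ k * f s b))"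
      by (subst sum.swap) (simp add: sum_distrib_right)
    also have "\<dots> = (\<Sum>s\<in>I. \<theta> s ^ Suc k * (e s a * f s b))"
      using eigen Suc.prems by (intro sum.cong) (simp_all add: mult_ac)
    finally show ?case .
  qed
  have "(\<lambda>k. \<Sum>s\<in>I. (\<theta> s ^ k /\<^sub>R fact k) * (e s a * f s b)) sums
      (\<Sum>s\<in>I. exp (\<theta> s) * (e s a * f s b))"
    by (intro sums_sum sums_mult2 exp_converges)
  moreover have "(\<lambda>k. \<Sum>s\<in>I. (\<theta> s ^ k /\<^sub>R fact k) * (e s a * f s b))
      = (\<lambda>k. matrix_pow V M k a b /\<^sub>R fact k)"
    using pow[OF assms(3)] by (simp add: scaleR_sum_right)
  ultimately show ?thesis
    unfolding matrix_exp_def by (simp add: sums_iff)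
qed

section \<open>Characters on even subsets\<close>

definition even_subsets :: "'a set \<Rightarrow> 'a set set" where
  "even_subsets X = {S. S \<subseteq> X \<and> even (card S)}"

definition parity_sign :: "'a set \<Rightarrow> 'a set \<Rightarrow> complex" where
  "parity_sign A B = (-1) ^ card (A \<inter> B)"

lemma finite_even_subsets [simp]: "finite X \<Longrightarrow> finite (even_subsets X)"
  by (rule finite_subset[of _ "Pow X"]) (auto simp: even_subsets_def)

lemma parity_sign_commute: "parity_sign A B = parity_sign B A"
  by (simp add: parity_sign_def Int_commute)

lemma parity_sign_prod:
  assumes "finite A"
  shows "parity_sign A B = (\<Prod>x\<in>A. if x \<in> B then -1 else 1)"
  using prod.inter_restrict[OF assms, of "\<lambda>_. - 1 :: complex" B] by (simp add: parity_sign_def)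

text \<open>This is the character property: an element of \<open>A\<close> lying in both
  \<open>B\<close> and \<open>C\<close> contributes two factors -1, which cancel.\<close>

lemma parity_sign_sym_diff:
  assumes "finite A"
  shows "parity_sign A (sym_diff B C) = parity_sign A B * parity_sign A C"
  unfolding parity_sign_prod[OF assms] prod.distrib[symmetric] by (rule prod.cong) auto

lemma cnj_parity_sign [simp]: "cnj (parity_sign A B) = parity_sign A B"
  by (simp add: parity_sign_def)

text \<open>The additive form avoids truncated subtraction and makes the parity of the symmetric
  difference visible.\<close>

lemma card_sym_diff:
  assumes "finite A" "finite B"
  shows "card (sym_diff A B) + 2 * card (A \<inter> B) = card A + card B"
proof -
  have "card (sym_diff A B) = card (A - B) + card (B - A)"
    using assms by (intro card_Un_disjoint) auto
  moreover have "card A = card (A - B) + card (A \<inter> B)" "card B = card (B - A) + card (A \<inter> B)"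
    using assms by (simp_all add: card_Diff_subset_Int Int_commute card_mono)
  ultimately show ?thesis by linarith
qed

lemma sym_diff_even_subsets:
  assumes "finite X" "A \<in> even_subsets X" "B \<in> even_subsets X"
  shows "sym_diff A B \<in> even_subsets X"
proof -
  have AB: "A \<subseteq> X" "B \<subseteq> X" "even (card A)" "even (card B)"
    using assms by (auto simp: even_subsets_def)
  have "even (card (sym_diff A B) + 2 * card (A \<inter> B))"
    using AB assms(1) by (subst card_sym_diff) (auto intro: finite_subset)
  with AB show ?thesis by (auto simp: even_subsets_def)
qed

lemma bij_betw_sym_diff_even_subsets:
  assumes "finite X" "R \<in> even_subsets X"
  shows "bij_betw (\<lambda>S. sym_diff S R) (even_subsets X) (even_subsets X)"
  by (rule bij_betw_byWitness[where f' = "\<lambda>S. sym_diff S R"])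
    (use sym_diff_even_subsets[OF assms(1) _ assms(2)] in auto)

section \<open>Character sums: generating function, orthogonality and Parseval identity\<close>

text \<open>Over all subsets the sum factors, each element of \<open>X\<close> contributing 1 + y
  outside \<open>B\<close> and 1 - y inside. Averaging the values at y = z and y = -z keeps the
  subsets of even size. The value z = 1 gives orthogonality, z = \<open>\<i>\<close> gives
  existence, and z on the unit circle gives nonexistence.\<close>

lemma sum_even_subsets_power_parity_sign:
  assumes "finite X"
  shows "(\<Sum>S\<in>even_subsets X. z ^ card S * parity_sign S B) =
    ((1 + z) ^ card (X - B) * (1 - z) ^ card (X \<inter> B) +
     (1 - z) ^ card (X - B) * (1 + z) ^ card (X \<inter> B)) / 2"
proof -
  have expand: "(\<Sum>S\<in>Pow X. y ^ card S * parity_sign S B) =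
      (1 + y) ^ card (X - B) * (1 - y) ^ card (X \<inter> B)" for y :: complex
  proof -
    \<comment> \<open>The product of ones over the complement gives the summand the shape of a term
      in the expansion of a product of two-term sums.\<close>
    have "(\<Sum>S\<in>Pow X. y ^ card S * parity_sign S B) =
        (\<Sum>S\<in>Pow X. (\<Prod>x\<in>S. y * (if x \<in> B then -1 else 1)) * (\<Prod>x\<in>X - S. 1))"
      using assms by (intro sum.cong)
        (auto simp: parity_sign_prod finite_subset prod.distrib)
    also have "\<dots> = (\<Prod>x\<in>X. y * (if x \<in> B then -1 else 1) + 1)"
      using prod_add[OF assms, of "\<lambda>x. y * (if x \<in> B then -1 else 1)" "\<lambda>x. 1"] by simp
    also have "\<dots> = (\<Prod>x\<in>X. if x \<in> B then 1 - y else 1 + y)"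
      by (rule prod.cong) auto
    also have "\<dots> = (1 + y) ^ card (X - B) * (1 - y) ^ card (X \<inter> B)"
      using assms by (simp add: prod.If_cases Diff_eq)
    finally show ?thesis .
  qed
  have "2 * (\<Sum>S\<in>even_subsets X. z ^ card S * parity_sign S B) =
      (\<Sum>S\<in>Pow X. if even (card S) then 2 * (z ^ card S * parity_sign S B) else 0)"
    using assms by (simp add: sum_distrib_left even_subsets_def sum.If_cases Pow_def Collect_conj_eq)
  also have "\<dots> = (\<Sum>S\<in>Pow X. z ^ card S * parity_sign S B + (-z) ^ card S * parity_sign S B)"
    by (rule sum.cong) (auto simp: power_minus_odd)
  finally have "(\<Sum>S\<in>even_subsets X. z ^ card S * parity_sign S B) * 2 = \<dots>"
    by (simp only: mult.commute)
  then show ?thesis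
    by (simp add: sum.distrib expand)
qed

text \<open>At z = 1 the factors 1 - z vanish, so only a zero exponent leaves anything. Both
  exceptional sets give the trivial character, \<open>X\<close> because every \<open>S\<close> in
  the sum has even size.\<close>

lemma sum_parity_sign:
  assumes "finite X" "X \<noteq> {}" "B \<subseteq> X"
  shows "(\<Sum>S\<in>even_subsets X. parity_sign S B) =
    (if B = {} \<or> B = X then 2 ^ (card X - 1) else 0)"
proof -
  have fB: "finite B" using assms finite_subset by blast
  have X: "X \<inter> B = B" "card X \<noteq> 0" using assms by auto
  have card: "card (X - B) = 0 \<longleftrightarrow> B = X" "card B = 0 \<longleftrightarrow> B = {}"
    using assms fB by auto
  have half: "(2::complex) ^ card X / 2 = 2 ^ (card X - 1)"
    using X by (cases "card X") auto
  have sum: "(\<Sum>S\<in>even_subsets X. parity_sign S B) =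
      (2 ^ card (X - B) * 0 ^ card B + 0 ^ card (X - B) * 2 ^ card B) / 2"
    using sum_even_subsets_power_parity_sign[OF assms(1), of 1 B] X by simp
  consider "B = {}" | "B = X" | "B \<noteq> {}" "B \<noteq> X" by blast
  then show ?thesis
    unfolding sum using assms(2) half X(2) card by cases (simp_all add: power_0_left)
qed

lemma card_even_subsets:
  assumes "finite X" "X \<noteq> {}"
  shows "card (even_subsets X) = 2 ^ (card X - 1)"
proof -
  have "complex_of_nat (card (even_subsets X)) = of_nat (2 ^ (card X - 1))"
    using sum_parity_sign[OF assms, of "{}"] by (simp add: parity_sign_def)
  then show ?thesis by (simp only: of_nat_eq_iff)
qed

text \<open>The product of two characters is the character of the symmetric difference, so the sum
  survives only when that difference is empty or all of \<open>X\<close>.\<close>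

lemma parity_sign_orthogonal:
  assumes "finite X" "X \<noteq> {}" "A \<subseteq> X" "B \<subseteq> X"
  shows "(\<Sum>S\<in>even_subsets X. parity_sign S A * parity_sign S B) =
    (if A = B \<or> A = X - B then 2 ^ (card X - 1) else 0)"
proof -
  have "(\<Sum>S\<in>even_subsets X. parity_sign S A * parity_sign S B)
      = (\<Sum>S\<in>even_subsets X. parity_sign S (sym_diff A B))"
    using assms by (intro sum.cong)
      (auto simp: even_subsets_def intro!: parity_sign_sym_diff[symmetric] intro: finite_subset)
  moreover have "sym_diff A B = {} \<longleftrightarrow> A = B" "sym_diff A B = X \<longleftrightarrow> A = X - B"
    using assms by auto
  moreover have "sym_diff A B \<subseteq> X" using assms by auto
  ultimately show ?thesis using sum_parity_sign[OF assms(1,2), of "sym_diff A B"] by presburger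
qed

text \<open>On even sets \<open>B\<close> the characters of \<open>S\<close> and
  \<open>X - S\<close> coincide. Orthogonality therefore leaves two diagonal terms for each
  \<open>S\<close>, whence the extra value of \<open>h\<close> at the complement.\<close>

lemma parseval_even_subsets:
  fixes g h :: "'a set \<Rightarrow> complex"
  assumes "finite X" "X \<noteq> {}" "even (card X)"
  shows "(\<Sum>B\<in>even_subsets X. (\<Sum>S\<in>even_subsets X. g S * parity_sign S B)
        * cnj (\<Sum>S\<in>even_subsets X. h S * parity_sign S B))
    = 2 ^ (card X - 1) * (\<Sum>S\<in>even_subsets X. g S * (cnj (h S) + cnj (h (X - S))))"
proof -
  let ?E = "even_subsets X"
  \<comment> \<open>Distinctness ensures that the later sum over \<open>{S, X - S}\<close> really
    has two terms.\<close>
  have compl: "X - S \<in> ?E" "S \<noteq> X - S" if "S \<in> ?E" for S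
    using that assms by (auto simp: even_subsets_def card_Diff_subset finite_subset)
  have "(\<Sum>B\<in>?E. (\<Sum>S\<in>?E. g S * parity_sign S B) * cnj (\<Sum>S\<in>?E. h S * parity_sign S B))
      = (\<Sum>B\<in>?E. \<Sum>S\<in>?E. \<Sum>T\<in>?E. g S * cnj (h T) * (parity_sign B S * parity_sign B T))"
    by (simp add: sum_product parity_sign_commute mult_ac)
  also have "\<dots> = (\<Sum>S\<in>?E. \<Sum>T\<in>?E. g S * cnj (h T) * (\<Sum>B\<in>?E. parity_sign B S * parity_sign B T))"
    by (subst sum.swap, rule sum.cong[OF refl], subst sum.swap) (simp add: sum_distrib_left)
  also have "\<dots> = (\<Sum>S\<in>?E. \<Sum>T\<in>?E. if T \<in> {S, X - S} then 2 ^ (card X - 1) * (g S * cnj (h T)) else 0)"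
  proof (intro sum.cong refl)
    fix S T assume "S \<in> ?E" "T \<in> ?E"
    then have "S \<subseteq> X" "T \<subseteq> X" by (auto simp: even_subsets_def)
    then show "g S * cnj (h T) * (\<Sum>B\<in>?E. parity_sign B S * parity_sign B T)
        = (if T \<in> {S, X - S} then 2 ^ (card X - 1) * (g S * cnj (h T)) else 0)"
      using parity_sign_orthogonal[OF assms(1,2), of S T] by auto
  qed
  also have "\<dots> = (\<Sum>S\<in>?E. \<Sum>T\<in>{S, X - S}. 2 ^ (card X - 1) * (g S * cnj (h T)))"
  proof (rule sum.cong[OF refl])
    fix S assume S: "S \<in> ?E"
    then have "?E \<inter> {S, X - S} = {S, X - S}" using compl by auto
    then show "(\<Sum>T\<in>?E. if T \<in> {S, X - S} then 2 ^ (card X - 1) * (g S * cnj (h T)) else 0)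
        = (\<Sum>T\<in>{S, X - S}. 2 ^ (card X - 1) * (g S * cnj (h T)))"
      using sum.inter_restrict[of ?E "\<lambda>T. 2 ^ (card X - 1) * (g S * cnj (h T))" "{S, X - S}"] assms
      by simp
  qed
  also have "\<dots> = 2 ^ (card X - 1) * (\<Sum>S\<in>?E. g S * (cnj (h S) + cnj (h (X - S))))"
    unfolding sum_distrib_left using compl(2) by (intro sum.cong refl) (simp add: algebra_simps)
  finally show ?thesis .
qed

section \<open>Sums over two-element sets\<close>

text \<open>Newton's identity expressing twice the second elementary symmetric polynomial through
  the first two power sums. The doubled form needs no division in the ring.\<close>

lemma sum_card_2_prod:
  fixes f :: "'a \<Rightarrow> 'b :: comm_ring_1"
  assumes "finite X"
  shows "2 * (\<Sum>P | P \<subseteq> X \<and> card P = 2. prod f P) = (sum f X)\<^sup>2 - (\<Sum>x\<in>X. (f x)\<^sup>2)"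
  using assms
proof (induction X rule: finite_induct)
  case empty
  have no_pair: "{P. P = {} \<and> card P = 2} = {}" by auto
  show ?case by (simp add: no_pair)
next
  case (insert x X)
  have split: "{P. P \<subseteq> insert x X \<and> card P = 2} = {P. P \<subseteq> X \<and> card P = 2} \<union> (\<lambda>y. {x, y}) ` X"
    using insert.hyps by (fastforce simp: card_2_iff)
  have "(\<Sum>P | P \<subseteq> insert x X \<and> card P = 2. prod f P) =
      (\<Sum>P | P \<subseteq> X \<and> card P = 2. prod f P) + (\<Sum>P\<in>(\<lambda>y. {x, y}) ` X. prod f P)"
    unfolding split using insert.hyps by (intro sum.union_disjoint) auto
  also have "(\<Sum>P\<in>(\<lambda>y. {x, y}) ` X. prod f P) = (\<Sum>y\<in>X. f x * f y)"
  proof (subst sum.reindex)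
    show "inj_on (\<lambda>y. {x, y}) X" by (auto simp: inj_on_def doubleton_eq_iff)
    have "prod f {x, y} = f x * f y" if "y \<in> X" for y
      using that insert.hyps by (cases "x = y") auto
    then show "sum (prod f \<circ> (\<lambda>y. {x, y})) X = (\<Sum>y\<in>X. f x * f y)" by simp
  qed
  finally show ?case
    using insert by (simp add: sum_distrib_left[symmetric] distrib_left power2_sum)
qed

text \<open>Newton's identity for values 1 and -1, whose squares sum to \<open>card X\<close>. The
  result is the Krawtchouk polynomial of degree 2 at \<open>card S\<close>, which is the eigenvalue
  of the halved cube.\<close>

lemma sum_card_2_parity_sign:
  assumes "finite X" "S \<subseteq> X"
  shows "(\<Sum>P | P \<subseteq> X \<and> card P = 2. parity_sign S P)
    = ((of_nat (card X) - 2 * of_nat (card S))\<^sup>2 - of_nat (card X)) / 2"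
proof -
  let ?f = "\<lambda>x. if x \<in> S then -1 else (1::complex)"
  have "(\<Sum>P | P \<subseteq> X \<and> card P = 2. parity_sign S P) = (\<Sum>P | P \<subseteq> X \<and> card P = 2. prod ?f P)"
    using assms by (intro sum.cong refl, subst parity_sign_commute)
      (auto intro!: parity_sign_prod intro: finite_subset)
  moreover have sum_f: "sum ?f X = of_nat (card X) - 2 * of_nat (card S)"
  proof -
    have "X \<inter> S = S" "card (X - S) + card S = card X"
      using assms by (auto simp: card_Diff_subset finite_subset card_mono)
    then show ?thesis
      using assms(1) by (simp add: sum.If_cases Diff_eq[symmetric] flip: of_nat_add)
  qed
  moreover have sum_sq: "(\<Sum>x\<in>X. (?f x)\<^sup>2) = of_nat (card X)"
  proof -
    have "(\<Sum>x\<in>X. (?f x)\<^sup>2) = (\<Sum>x\<in>X. 1)" by (rule sum.cong) auto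
    then show ?thesis by simp
  qed
  ultimately show ?thesis
    using sum_card_2_prod[OF assms(1), of ?f, unfolded sum_f sum_sq]
    by (simp only: eq_divide_eq_numeral1 mult.commute) simp
qed


section \<open>Words and classes of the folded halved cube\<close>

definition word_of_set :: "nat \<Rightarrow> nat set \<Rightarrow> bool list" where
  "word_of_set n A = map (\<lambda>i. i \<in> A) [0..<n]"

definition antipodal_class :: "nat \<Rightarrow> nat set \<Rightarrow> bool list set" where
  "antipodal_class n A = {word_of_set n A, word_of_set n ({..<n} - A)}"

lemma length_word_of_set [simp]: "length (word_of_set n A) = n"
  by (simp add: word_of_set_def)

lemma nth_word_of_set [simp]: "i < n \<Longrightarrow> word_of_set n A ! i \<longleftrightarrow> i \<in> A"
  by (simp add: word_of_set_def)

lemma word_of_set_eq_iff: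
  "A \<subseteq> {..<n} \<Longrightarrow> B \<subseteq> {..<n} \<Longrightarrow> word_of_set n A = word_of_set n B \<longleftrightarrow> A = B"
  by (auto simp: list_eq_iff_nth_eq)

lemma map_Not_word_of_set: "map Not (word_of_set n A) = word_of_set n ({..<n} - A)"
  by (simp add: list_eq_iff_nth_eq)

lemma count_list_word_of_set:
  assumes "A \<subseteq> {..<n}"
  shows "count_list (word_of_set n A) True = card A"
proof -
  have "count_list (word_of_set n A) True = card {i. i < n \<and> word_of_set n A ! i = True}"
    by (simp add: count_list_eq_length_filter length_filter_conv_card eq_commute)
  also have "{i. i < n \<and> word_of_set n A ! i = True} = A" using assms by auto
  finally show ?thesis .
qed

lemma card_diff_word_of_set:
  assumes "A \<subseteq> {..<n}" "B \<subseteq> {..<n}"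
  shows "card {i. i < n \<and> word_of_set n A ! i \<noteq> word_of_set n B ! i} = card (sym_diff A B)"
  by (rule arg_cong[of _ _ card]) (use assms in auto)

lemma pverts_halved_cube: "pverts (halved_cube n) = word_of_set n ` even_subsets {..<n}"
proof -
  have "a \<in> word_of_set n ` even_subsets {..<n}" if "length a = n" "even (count_list a True)" for a
  proof (rule image_eqI[of _ _ "{i. i < n \<and> a ! i}"])
    show eq: "a = word_of_set n {i. i < n \<and> a ! i}"
      using that by (simp add: list_eq_iff_nth_eq)
    have "count_list a True = card {i. i < n \<and> a ! i}"
      by (subst eq, rule count_list_word_of_set) auto
    then show "{i. i < n \<and> a ! i} \<in> even_subsets {..<n}"
      using that by (auto simp: even_subsets_def)
  qed
  then show ?thesis
    by (auto simp: halved_cube_def Let_def even_subsets_def count_list_word_of_set)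
qed

lemma parcs_halved_cube:
  assumes "A \<in> even_subsets {..<n}" "B \<in> even_subsets {..<n}"
  shows "(word_of_set n A, word_of_set n B) \<in> parcs (halved_cube n) \<longleftrightarrow> card (sym_diff A B) = 2"
  using assms card_diff_word_of_set[of A n B]
  by (simp add: halved_cube_def even_subsets_def count_list_word_of_set)

lemma Diff_even_subsets:
  assumes "finite X" "even (card X)" "A \<in> even_subsets X"
  shows "X - A \<in> even_subsets X"
  using assms by (auto simp: even_subsets_def card_Diff_subset finite_subset)

lemma antipodal_rel_Image:
  assumes "even n" "A \<in> even_subsets {..<n}"
  shows "antipodal_rel n `` {word_of_set n A} = antipodal_class n A"
proof -
  have "{..<n} - A \<in> even_subsets {..<n}" using assms by (intro Diff_even_subsets) auto
  then show ?thesis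
    using assms
    by (auto simp: antipodal_rel_def antipodal_class_def pverts_halved_cube map_Not_word_of_set)
qed

lemma pverts_folded_halved_cube:
  "pverts (folded_halved_cube m) = antipodal_class (2 * m) ` even_subsets {..<2 * m}"
  by (auto simp: folded_halved_cube_def quotient_graph_def quotient_def pverts_halved_cube
      antipodal_rel_Image)

lemma antipodal_class_eq_iff:
  assumes "A \<subseteq> {..<n}" "B \<subseteq> {..<n}"
  shows "antipodal_class n A = antipodal_class n B \<longleftrightarrow> A = B \<or> A = {..<n} - B"
proof -
  have "{..<n} - A = {..<n} - B \<longleftrightarrow> A = B" "{..<n} - A = B \<longleftrightarrow> A = {..<n} - B"
    using assms by auto
  then show ?thesis
    using assms by (auto simp: antipodal_class_def doubleton_eq_iff word_of_set_eq_iff)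
qed

text \<open>Every vertex has exactly two representatives, a set and its complement, which differ
  because n > 0. The semiring is left general so that the lemma serves both for counting vertices
  and for complex matrix sums.\<close>

lemma sum_antipodal_class:
  fixes g :: "bool list set \<Rightarrow> 'b :: comm_semiring_1"
  assumes "even n" "n > 0"
  shows "(\<Sum>A\<in>even_subsets {..<n}. g (antipodal_class n A))
    = 2 * (\<Sum>q\<in>antipodal_class n ` even_subsets {..<n}. g q)"
proof -
  let ?E = "even_subsets {..<n}" and ?q = "antipodal_class n"
  have "(\<Sum>A\<in>?E. g (?q A)) = (\<Sum>q\<in>?q ` ?E. \<Sum>A | A \<in> ?E \<and> ?q A = q. g (?q A))"
    by (rule sum.image_gen) simp
  also have "\<dots> = (\<Sum>q\<in>?q ` ?E. 2 * g q)"
  proof (rule sum.cong[OF refl])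
    fix q assume "q \<in> ?q ` ?E"
    then obtain B where B: "B \<in> ?E" "q = ?q B" by auto
    have B': "B \<subseteq> {..<n}" "{..<n} - B \<in> ?E"
      using B assms by (auto simp: even_subsets_def intro!: Diff_even_subsets[unfolded even_subsets_def, simplified])
    have compl: "?q ({..<n} - B) = q"
      unfolding B(2) antipodal_class_def double_diff[OF B'(1) order_refl] by (rule insert_commute)
    have "A = B \<or> A = {..<n} - B" if "A \<in> ?E" "?q A = q" for A
      using that B B'(1) antipodal_class_eq_iff[of A n B] by (auto simp: even_subsets_def)
    then have "{A. A \<in> ?E \<and> ?q A = q} = {B, {..<n} - B}"
      using B B'(2) compl by blast
    moreover have "B \<noteq> {..<n} - B" using assms(2) by auto
    moreover note compl
    ultimately show "(\<Sum>A | A \<in> ?E \<and> ?q A = q. g (?q A)) = 2 * g q"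
      using B by (simp add: mult_2)
  qed
  finally show ?thesis by (simp add: sum_distrib_left)
qed

lemma card_pverts_folded_halved_cube:
  assumes "m > 0"
  shows "card (pverts (folded_halved_cube m)) = 2 ^ (2 * m - 2)"
proof -
  have "2 * card (pverts (folded_halved_cube m)) = card (even_subsets {..<2 * m})"
    using sum_antipodal_class[of "2 * m" "\<lambda>_. 1 :: nat"] assms
    by (simp add: pverts_folded_halved_cube)
  also have "\<dots> = 2 ^ (2 * m - 1)"
    using assms by (simp add: card_even_subsets lessThan_empty_iff)
  also have "2 * m - 1 = Suc (2 * m - 2)" using assms by simp
  finally show ?thesis by simp
qed

text \<open>Complementing both sets preserves their symmetric difference, so the four pairs of
  representatives give only two conditions.\<close>

lemma parcs_folded_halved_cube:
  assumes "A \<in> even_subsets {..<2 * m}" "B \<in> even_subsets {..<2 * m}"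
  shows "(antipodal_class (2 * m) A, antipodal_class (2 * m) B) \<in> parcs (folded_halved_cube m)
    \<longleftrightarrow> card (sym_diff A B) = 2 \<or> card (sym_diff A ({..<2 * m} - B)) = 2"
proof -
  let ?X = "{..<2 * m}"
  have sub: "A \<subseteq> ?X" "B \<subseteq> ?X" using assms by (auto simp: even_subsets_def)
  have compl: "?X - A \<in> even_subsets ?X" "?X - B \<in> even_subsets ?X"
    using assms by (auto intro!: Diff_even_subsets)
  have "sym_diff (?X - A) (?X - B) = sym_diff A B" "sym_diff (?X - A) B = sym_diff A (?X - B)"
    using sub by auto
  then show ?thesis
    using assms compl pverts_folded_halved_cube[of m]
    by (auto simp: folded_halved_cube_def quotient_graph_def antipodal_class_def parcs_halved_cube)
qed


text \<open>The character of \<open>X\<close> itself is trivial on even sets. Hence the character of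
  an even \<open>S\<close> is constant on antipodal classes and descends to the folded
  graph.\<close>

lemma parity_sign_Diff:
  assumes "finite X" "S \<in> even_subsets X" "A \<subseteq> X"
  shows "parity_sign S (X - A) = parity_sign S A"
proof -
  have S: "S \<subseteq> X" "even (card S)" "finite S"
    using assms by (auto simp: even_subsets_def finite_subset)
  have "X - A = sym_diff X A" using assms(3) by auto
  moreover have "parity_sign S X = 1"
    using S by (simp add: parity_sign_def Int_absorb2)
  ultimately show ?thesis using parity_sign_sym_diff[OF S(3), of X A] by simp
qed

lemma card_sym_diff_Diff:
  assumes "finite X" "A \<subseteq> X" "B \<subseteq> X"
  shows "card (sym_diff A (X - B)) = card X - card (sym_diff A B)"
proof -
  have "sym_diff A (X - B) = X - sym_diff A B" using assms by auto
  moreover have "sym_diff A B \<subseteq> X" using assms by auto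
  ultimately show ?thesis
    using card_Diff_subset[of "sym_diff A B" X] assms(1) by (metis finite_subset)
qed

section \<open>Spectrum of the folded halved cube\<close>

text \<open>
  For \<open>m = 2\<close> two adjacent classes are joined by two edges at each representative, whence the
  factor \<open>1/2\<close>.
\<close>

definition folded_eigenvalue :: "nat \<Rightarrow> nat \<Rightarrow> real" where
  "folded_eigenvalue m k = (if m = 2 then 1/2 else 1) * (2 * (real m - real k)\<^sup>2 - real m)"

text \<open>The halved cube is a Cayley graph: the neighbours of \<open>A\<close> are its translates
  by two-element sets \<open>P\<close>. The character property pulls out the value at
  \<open>A\<close> and leaves a sum over \<open>P\<close>.\<close>

lemma sum_adjacent_parity_sign:
  assumes "finite X" "S \<in> even_subsets X" "A \<in> even_subsets X"
  shows "(\<Sum>B\<in>even_subsets X. of_bool (card (sym_diff A B) = 2) * parity_sign S B)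
    = parity_sign S A * (((of_nat (card X) - 2 * of_nat (card S))\<^sup>2 - of_nat (card X)) / 2)"
proof -
  let ?E = "even_subsets X"
  have S: "S \<subseteq> X" "finite S" using assms by (auto simp: even_subsets_def finite_subset)
  have involution: "sym_diff A (sym_diff P A) = P" for P by auto
  have "(\<Sum>B\<in>?E. of_bool (card (sym_diff A B) = 2) * parity_sign S B)
      = (\<Sum>P\<in>?E. of_bool (card P = 2) * parity_sign S (sym_diff P A))"
    by (subst sum.reindex_bij_betw[OF bij_betw_sym_diff_even_subsets[OF assms(1,3)], symmetric])
      (simp only: involution)
  also have "\<dots> = parity_sign S A * (\<Sum>P\<in>?E. of_bool (card P = 2) * parity_sign S P)"
    by (simp add: parity_sign_sym_diff[OF S(2)] sum_distrib_left mult_ac)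
  also have "(\<Sum>P\<in>?E. of_bool (card P = 2) * parity_sign S P)
      = (\<Sum>P | P \<subseteq> X \<and> card P = 2. parity_sign S P)"
    using assms(1) by (intro sum.mono_neutral_cong_right) (auto simp: even_subsets_def)
  finally show ?thesis unfolding sum_card_2_parity_sign[OF assms(1) S(1)] .
qed

section \<open>Eigenvectors, walk matrix and the flatness criterion\<close>

context
  fixes m :: nat
  assumes m2: "m \<ge> 2"
begin

abbreviation (input) E where "E \<equiv> even_subsets {..<2 * m}"
abbreviation (input) cls where "cls \<equiv> antipodal_class (2 * m)"
abbreviation (input) G where "G \<equiv> folded_halved_cube m"

text \<open>Characters are evaluated on vertices through a representative picked by
  \<open>inv_into\<close>; since it is \<open>A\<close> or its complement, the choice does not
  matter.\<close>

lemma parity_sign_representative: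
  assumes "S \<in> E" "A \<in> E"
  shows "parity_sign S (inv_into E cls (cls A)) = parity_sign S A"
proof -
  let ?B = "inv_into E cls (cls A)"
  have B: "?B \<in> E" "cls ?B = cls A"
    using assms by (auto intro!: inv_into_into f_inv_into_f[of _ cls])
  then have "?B = A \<or> ?B = {..<2 * m} - A"
    using assms antipodal_class_eq_iff[of ?B "2 * m" A] by (auto simp: even_subsets_def)
  then show ?thesis
    using parity_sign_Diff[of "{..<2 * m}" S A] assms by (auto simp: even_subsets_def)
qed

text \<open>Summing over even sets counts every vertex twice, while adjacency through
  \<open>B\<close> and through its complement contribute equally. The two factors of 2 cancel, which
  leaves the eigenvalue of the halved cube up to the correction for m = 2.\<close>

lemma adjacency_eigenvector:
  assumes "S \<in> E" "A \<in> E"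
  shows "(\<Sum>y\<in>pverts G. adjacency_matrix G (cls A) y * parity_sign S (inv_into E cls y))
    = of_real (folded_eigenvalue m (card S)) * parity_sign S A"
proof -
  let ?X = "{..<2 * m}"
  let ?c = "if m = 2 then 1/2 else (1::complex)"
  let ?near = "\<lambda>B. of_bool (card (sym_diff A B) = 2) :: complex"
  have A: "A \<subseteq> ?X" using assms by (auto simp: even_subsets_def)
  have compl_near: "(\<Sum>B\<in>E. ?near (?X - B) * parity_sign S B) = (\<Sum>B\<in>E. ?near B * parity_sign S B)"
  proof -
    have "bij_betw (\<lambda>B. ?X - B) E E"
      by (rule bij_betw_byWitness[where f' = "\<lambda>B. ?X - B"])
        (auto intro!: Diff_even_subsets simp: double_diff, auto simp: even_subsets_def)
    then have "(\<Sum>B\<in>E. ?near B * parity_sign S B) = (\<Sum>B\<in>E. ?near (?X - B) * parity_sign S (?X - B))"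
      by (rule sum.reindex_bij_betw[symmetric])
    also have "\<dots> = (\<Sum>B\<in>E. ?near (?X - B) * parity_sign S B)"
      using assms by (intro sum.cong refl) (subst parity_sign_Diff, auto simp: even_subsets_def)
    finally show ?thesis by simp
  qed
  \<comment> \<open>The two distances add up to 2m. For m = 2 both equal 2 or neither does, so the
    factor 1/2 repairs the double count; for larger m at most one of them is 2.\<close>
  have adj: "adjacency_matrix G (cls A) (cls B) = ?c * (?near B + ?near (?X - B))" if "B \<in> E" for B
  proof -
    have "B \<subseteq> ?X" using that by (auto simp: even_subsets_def)
    then have "card (sym_diff A (?X - B)) = 2 * m - card (sym_diff A B)"
      using card_sym_diff_Diff[of ?X A B] A by simp
    then show ?thesis
      using m2 by (auto simp: adjacency_matrix_def parcs_folded_halved_cube[OF assms(2) that])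
  qed
  have "2 * (\<Sum>y\<in>pverts G. adjacency_matrix G (cls A) y * parity_sign S (inv_into E cls y))
      = (\<Sum>B\<in>E. adjacency_matrix G (cls A) (cls B) * parity_sign S (inv_into E cls (cls B)))"
    unfolding pverts_folded_halved_cube using m2 by (intro sum_antipodal_class[symmetric]) auto
  also have "\<dots> = (\<Sum>B\<in>E. ?c * (?near B * parity_sign S B + ?near (?X - B) * parity_sign S B))"
    using assms by (intro sum.cong refl) (simp only: parity_sign_representative adj distrib_right distrib_left mult.assoc)
  also have "\<dots> = 2 * (?c * (\<Sum>B\<in>E. ?near B * parity_sign S B))"
    by (simp add: sum_distrib_left[symmetric] sum.distrib compl_near)
  also have "(\<Sum>B\<in>E. ?near B * parity_sign S B)
      = parity_sign S A * (((of_nat (card ?X) - 2 * of_nat (card S))\<^sup>2 - of_nat (card ?X)) / 2)"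
    using assms by (intro sum_adjacent_parity_sign) auto
  also have "((of_nat (card ?X) - 2 * of_nat (card S))\<^sup>2 - of_nat (card ?X)) / 2
      = (2 * (of_nat m - of_nat (card S))\<^sup>2 - of_nat m :: complex)"
    by (simp add: power2_eq_square field_simps)
  finally show ?thesis
    by (simp add: folded_eigenvalue_def mult_ac)
qed

text \<open>The index \<open>S\<close> runs over all even sets although \<open>S\<close> and its
  complement give the same eigenvector. This double count is why the normalisation is
  \<open>2 ^ (2 * m - 1)\<close>, twice the number of vertices.\<close>

lemma walk_matrix_folded_halved_cube:
  assumes "A \<in> E" "B \<in> E"
  shows "walk_matrix G \<tau> (cls A) (cls B) =
    (\<Sum>S\<in>E. cis (- \<tau> * folded_eigenvalue m (card S)) * parity_sign S (sym_diff A B)) / 2 ^ (2 * m - 1)"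
proof -
  let ?X = "{..<2 * m}"
  let ?e = "\<lambda>S y. parity_sign S (inv_into E cls y)"
  have X: "finite ?X" "?X \<noteq> {}" "card ?X = 2 * m" using m2 by (auto simp: lessThan_empty_iff)
  have "walk_matrix G \<tau> (cls A) (cls B) =
    (\<Sum>S\<in>E. exp (- \<i> * \<tau> * folded_eigenvalue m (card S)) * (?e S (cls A) * (?e S (cls B) / 2 ^ (2 * m - 1))))"
    unfolding walk_matrix_def
  proof (rule matrix_exp_spectral)
    show "cls A \<in> pverts G" "cls B \<in> pverts G"
      using assms by (auto simp: pverts_folded_halved_cube)
  next
    fix a b assume "a \<in> pverts G" "b \<in> pverts G"
    then obtain C D where CD: "C \<in> E" "D \<in> E" "a = cls C" "b = cls D"
      by (auto simp: pverts_folded_halved_cube)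
    then have sub: "C \<subseteq> ?X" "D \<subseteq> ?X" by (auto simp: even_subsets_def)
    have "(\<Sum>S\<in>E. ?e S a * (?e S b / 2 ^ (2 * m - 1)))
        = (\<Sum>S\<in>E. parity_sign S C * parity_sign S D) / 2 ^ (2 * m - 1)"
      unfolding sum_divide_distrib using CD
      by (intro sum.cong refl) (simp add: parity_sign_representative)
    also have "\<dots> = (if a = b then 1 else 0)"
      using parity_sign_orthogonal[OF X(1,2) sub] antipodal_class_eq_iff[OF sub] X(3) CD
      by simp
    finally show "(\<Sum>S\<in>E. ?e S a * (?e S b / 2 ^ (2 * m - 1))) = (if a = b then 1 else 0)" .
  next
    fix S a assume S: "S \<in> E" and "a \<in> pverts G"
    then obtain C where C: "C \<in> E" "a = cls C" by (auto simp: pverts_folded_halved_cube)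
    have "(\<Sum>v\<in>pverts G. - \<i> * \<tau> * adjacency_matrix G a v * ?e S v)
        = - \<i> * \<tau> * (\<Sum>v\<in>pverts G. adjacency_matrix G a v * ?e S v)"
      by (simp only: sum_distrib_left mult.assoc)
    also have "\<dots> = - \<i> * \<tau> * folded_eigenvalue m (card S) * ?e S a"
      unfolding C(2) adjacency_eigenvector[OF S C(1)] parity_sign_representative[OF S C(1)]
      by (simp only: mult.assoc)
    finally show "(\<Sum>v\<in>pverts G. - \<i> * \<tau> * adjacency_matrix G a v * ?e S v)
        = - \<i> * \<tau> * folded_eigenvalue m (card S) * ?e S a" .
  qed
  also have "\<dots> = (\<Sum>S\<in>E. cis (- \<tau> * folded_eigenvalue m (card S)) * parity_sign S (sym_diff A B) / 2 ^ (2 * m - 1))"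
  proof (rule sum.cong[OF refl])
    fix S assume S: "S \<in> E"
    then have "finite S" by (auto simp: even_subsets_def finite_subset)
    with S show "exp (- \<i> * \<tau> * folded_eigenvalue m (card S)) * (?e S (cls A) * (?e S (cls B) / 2 ^ (2 * m - 1)))
        = cis (- \<tau> * folded_eigenvalue m (card S)) * parity_sign S (sym_diff A B) / 2 ^ (2 * m - 1)"
      unfolding parity_sign_representative[OF S assms(1)] parity_sign_representative[OF S assms(2)]
      by (simp add: parity_sign_sym_diff cis_conv_exp mult.assoc)
  qed
  finally show ?thesis by (simp add: sum_divide_distrib)
qed

text \<open>An entry of the walk matrix depends only on the symmetric difference of its indices, and
  taking the first index empty reaches every even set. The bound \<open>2 ^ m\<close> is the
  quotient of the normalisation by the square root of the number of vertices.\<close>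

lemma uniform_mixing_folded_halved_cube_iff:
  "uniform_mixing_at G \<tau> \<longleftrightarrow>
    (\<forall>B\<in>E. norm (\<Sum>S\<in>E. cis (- \<tau> * folded_eigenvalue m (card S)) * parity_sign S B) = 2 ^ m)"
proof -
  let ?F = "\<lambda>B. \<Sum>S\<in>E. cis (- \<tau> * folded_eigenvalue m (card S)) * parity_sign S B"
  have pow: "(2::real) ^ (2 * m - 1) = 2 ^ m * 2 ^ (m - 1)" "(2::real) ^ (2 * m - 2) = (2 ^ (m - 1))\<^sup>2"
    using m2 by (simp_all flip: power_add power_mult add: algebra_simps)
  have flat: "norm (walk_matrix G \<tau> (cls A) (cls B)) = 1 / sqrt (real (card (pverts G)))
      \<longleftrightarrow> norm (?F (sym_diff A B)) = 2 ^ m" if "A \<in> E" "B \<in> E" for A B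
  proof -
    have "card (pverts G) = 2 ^ (2 * m - 2)"
      using m2 by (intro card_pverts_folded_halved_cube) simp
    then have sqrt_card: "sqrt (real (card (pverts G))) = 2 ^ (m - 1)"
      by (simp add: pow)
    show ?thesis
      unfolding sqrt_card walk_matrix_folded_halved_cube[OF that]
      by (simp only: norm_divide norm_power norm_numeral pow(1)) (auto simp: field_simps)
  qed
  have "uniform_mixing_at G \<tau> \<longleftrightarrow> (\<forall>A\<in>E. \<forall>B\<in>E. norm (?F (sym_diff A B)) = 2 ^ m)"
    using flat[unfolded pverts_folded_halved_cube]
    by (simp add: uniform_mixing_at_def pverts_folded_halved_cube)
  also have "\<dots> \<longleftrightarrow> (\<forall>B\<in>E. norm (?F B) = 2 ^ m)"
  proof
    assume *: "\<forall>A\<in>E. \<forall>B\<in>E. norm (?F (sym_diff A B)) = 2 ^ m"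
    have "{} \<in> E" by (simp add: even_subsets_def)
    with * have "\<forall>B\<in>E. norm (?F (sym_diff {} B)) = 2 ^ m" by blast
    then show "\<forall>B\<in>E. norm (?F B) = 2 ^ m" by simp
  qed (use sym_diff_even_subsets[of "{..<2 * m}"] in blast)
  finally show ?thesis .
qed

end


section \<open>Existence for even \<open>m\<close>\<close>

text \<open>For m = 2 the doubled time compensates the halved eigenvalue. Writing m = 2a and k = 2b,
  the cross term of the square becomes the full turns 2 pi a b, and the term in k becomes -pi b^2,
  whose phase is (-1)^b = \<open>\<i> ^ k\<close>.\<close>

lemma cis_folded_eigenvalue:
  assumes "even m" "even k"
  shows "cis (- (if m = 2 then pi / 4 else pi / 8) * folded_eigenvalue m k)
    = cis (pi * real m / 8 - pi * (real m)\<^sup>2 / 4) * \<i> ^ k"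
proof -
  obtain a where a: "m = 2 * a" using assms(1) by (rule evenE)
  obtain b where b: "k = 2 * b" using assms(2) by (rule evenE)
  note ab = a b
  have "- (if m = 2 then pi / 4 else pi / 8) * folded_eigenvalue m k
      = - pi / 8 * (2 * (real m - real k)\<^sup>2 - real m)"
    by (simp add: folded_eigenvalue_def)
  also have "\<dots> = (pi * real m / 8 - pi * (real m)\<^sup>2 / 4) + 2 * pi * real (a * b) + real (b * b) * (- pi)"
    by (simp add: ab power2_eq_square field_simps)
  finally have "cis (- (if m = 2 then pi / 4 else pi / 8) * folded_eigenvalue m k)
      = cis (pi * real m / 8 - pi * (real m)\<^sup>2 / 4) * cis (2 * pi * real (a * b)) * cis (- pi) ^ (b * b)"
    by (simp only: cis_mult Complex.DeMoivre)
  also have "cis (2 * pi * real (a * b)) = 1"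
    by (rule cis_multiple_2pi) simp
  also have "cis (- pi) ^ (b * b) = \<i> ^ k"
    by (simp add: ab power_mult minus_one_power_iff complex_eq_iff)
  finally show ?thesis by simp
qed

lemma norm_sum_imaginary_power_parity_sign:
  assumes "finite X" "card X = 2 * m" "even m" "B \<in> even_subsets X"
  shows "norm (\<Sum>S\<in>even_subsets X. \<i> ^ card S * parity_sign S B) = 2 ^ m"
proof -
  have B: "X \<inter> B = B" "B \<subseteq> X" "finite B" "even (card B)"
    using assms by (auto simp: even_subsets_def finite_subset)
  then obtain r where r: "card B = 2 * r" by (auto elim: evenE)
  have "card B \<le> card X" using B assms(1) by (intro card_mono)
  with r assms(2) have "r \<le> m" by simp
  then obtain p where p: "m = p + r" by (metis le_add_diff_inverse2)
  have card: "card (X - B) = 2 * p"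
    using B assms(2) r p by (simp add: card_Diff_subset)
  have sq: "(1 + \<i>)\<^sup>2 = 2 * \<i>" "(1 - \<i>)\<^sup>2 = - (2 * \<i>)"
    by (simp_all add: power2_eq_square algebra_simps)
  \<comment> \<open>Here evenness of m matters: the two products of the generating function get
    equal signs and add up instead of cancelling.\<close>
  have same_parity: "(- 1 :: complex) ^ p = (- 1) ^ r"
    using assms(3) p by (cases "even r") auto
  have "(\<Sum>S\<in>even_subsets X. \<i> ^ card S * parity_sign S B)
      = ((2 * \<i>) ^ p * (- (2 * \<i>)) ^ r + (- (2 * \<i>)) ^ p * (2 * \<i>) ^ r) / 2"
    unfolding sum_even_subsets_power_parity_sign[OF assms(1)] B(1) card r power_mult sq ..
  also have "\<dots> = (2 * \<i>) ^ m * (- 1) ^ r"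
    unfolding p power_add power_minus[of "2 * \<i>"] same_parity by simp
  finally show ?thesis by (simp add: norm_mult norm_power)
qed

lemma admits_uniform_mixing_if_even:
  assumes "m \<ge> 2" "even m"
  shows "admits_uniform_mixing (folded_halved_cube m)"
  unfolding admits_uniform_mixing_def uniform_mixing_folded_halved_cube_iff[OF assms(1)]
proof (intro exI[of _ "if m = 2 then pi / 4 else pi / 8"] ballI)
  fix B assume B: "B \<in> even_subsets {..<2 * m}"
  have "(\<Sum>S\<in>even_subsets {..<2 * m}.
        cis (- (if m = 2 then pi / 4 else pi / 8) * folded_eigenvalue m (card S)) * parity_sign S B)
      = cis (pi * real m / 8 - pi * (real m)\<^sup>2 / 4)
        * (\<Sum>S\<in>even_subsets {..<2 * m}. \<i> ^ card S * parity_sign S B)"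
    unfolding sum_distrib_left
    by (intro sum.cong refl, subst cis_folded_eigenvalue) (use assms in \<open>auto simp: even_subsets_def\<close>)
  then show "norm (\<Sum>S\<in>even_subsets {..<2 * m}.
      cis (- (if m = 2 then pi / 4 else pi / 8) * folded_eigenvalue m (card S)) * parity_sign S B) = 2 ^ m"
    using B assms(2) by (simp add: norm_mult norm_sum_imaginary_power_parity_sign)
qed

section \<open>Nonexistence for odd \<open>m\<close>\<close>

lemma sum_cos_even_subsets_nonneg:
  fixes x :: real
  assumes "finite Y" "card Y = 2 * n" "even n"
  shows "(\<Sum>T\<in>even_subsets Y. cos (x * (real n - real (card T)))) \<ge> 0"
proof -
  \<comment> \<open>Half-angle factors turn 1 + z and 1 - z into 2 cos(x/2) and 2i sin(x/2). With n
    even, the 2n-th powers of both are nonnegative reals.\<close>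
  define y where "y = cis (x / 2)"
  define z where "z = cis (- x)"
  have yz: "y * (1 + z) = of_real (2 * cos (x / 2))" "y * (1 - z) = 2 * \<i> * of_real (sin (x / 2))"
    by (simp_all add: y_def z_def distrib_left right_diff_distrib cis_mult complex_eq_iff)
  have y_pow: "y ^ (2 * n) = cis (x * real n)"
    unfolding y_def Complex.DeMoivre by (simp add: mult.commute)
  have parity_sign_empty: "parity_sign T {} = 1" for T :: "'a set"
    by (simp add: parity_sign_def)
  have "(\<Sum>T\<in>even_subsets Y. cis (x * (real n - real (card T))))
      = y ^ (2 * n) * (\<Sum>T\<in>even_subsets Y. z ^ card T * parity_sign T {})"
    unfolding sum_distrib_left y_pow
    by (intro sum.cong refl) (simp add: z_def Complex.DeMoivre cis_mult parity_sign_empty algebra_simps)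
  also have "\<dots> = ((y * (1 + z)) ^ (2 * n) + (y * (1 - z)) ^ (2 * n)) / 2"
    unfolding sum_even_subsets_power_parity_sign[OF assms(1)]
    by (simp add: assms(2) power_mult_distrib distrib_left[of "y ^ (2 * n)"])
  also have "\<dots> = of_real (((2 * cos (x / 2)) ^ (2 * n) + (4 * (sin (x / 2))\<^sup>2) ^ n) / 2)"
  proof -
    have "(2 * \<i> * of_real (sin (x / 2))) ^ (2 * n) = (- of_real (4 * (sin (x / 2))\<^sup>2) :: complex) ^ n"
      by (simp add: power_mult power_mult_distrib)
    then show ?thesis
      unfolding yz using assms(3) by simp
  qed
  finally have "Re (\<Sum>T\<in>even_subsets Y. cis (x * (real n - real (card T))))
      = ((2 * cos (x / 2)) ^ (2 * n) + (4 * (sin (x / 2))\<^sup>2) ^ n) / 2"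
    by (simp only: Re_complex_of_real)
  also have "\<dots> \<ge> 0" by (simp add: zero_le_even_power)
  finally show ?thesis by simp
qed

text \<open>Translating \<open>g\<close> by \<open>R\<close> multiplies its transform by the
  character of \<open>R\<close>. By Parseval and flatness, the autocorrelation is then a multiple of
  the sum of a nontrivial character, which vanishes; the symmetry of \<open>g\<close> merges the two
  Parseval terms.\<close>

lemma autocorrelation_eq_0:
  fixes g :: "'a set \<Rightarrow> complex"
  assumes X: "finite X" "X \<noteq> {}" "even (card X)"
    and sym: "\<And>S. S \<in> even_subsets X \<Longrightarrow> g (X - S) = g S"
    and flat: "\<And>B. B \<in> even_subsets X \<Longrightarrow> norm (\<Sum>S\<in>even_subsets X. g S * parity_sign S B) = c"
    and R: "R \<in> even_subsets X" "R \<noteq> {}" "R \<noteq> X"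
  shows "(\<Sum>S\<in>even_subsets X. g (sym_diff S R) * cnj (g S)) = 0"
proof -
  let ?E = "even_subsets X"
  let ?F = "\<lambda>B. \<Sum>S\<in>?E. g S * parity_sign S B"
  have shift: "(\<Sum>S\<in>?E. g (sym_diff S R) * parity_sign S B) = parity_sign B R * ?F B" if "B \<in> ?E" for B
  proof -
    have "finite B" using that X(1) by (auto simp: even_subsets_def finite_subset)
    have involution: "sym_diff (sym_diff S R) R = S" for S by auto
    have "(\<Sum>S\<in>?E. g (sym_diff S R) * parity_sign S B)
        = (\<Sum>S\<in>?E. g S * parity_sign (sym_diff S R) B)"
      by (subst sum.reindex_bij_betw[OF bij_betw_sym_diff_even_subsets[OF X(1) R(1)], symmetric])
        (simp only: involution)
    also have "\<dots> = (\<Sum>S\<in>?E. g S * (parity_sign B S * parity_sign B R))"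
      using parity_sign_sym_diff[OF \<open>finite B\<close>] by (simp add: parity_sign_commute[of _ B])
    finally show ?thesis by (simp add: sum_distrib_left parity_sign_commute[of _ B] mult_ac)
  qed
  have "2 ^ (card X - 1) * (\<Sum>S\<in>?E. g (sym_diff S R) * (cnj (g S) + cnj (g (X - S))))
      = (\<Sum>B\<in>?E. (\<Sum>S\<in>?E. g (sym_diff S R) * parity_sign S B) * cnj (?F B))"
    by (rule parseval_even_subsets[OF X, symmetric])
  also have "\<dots> = (\<Sum>B\<in>?E. parity_sign B R * ?F B * cnj (?F B))"
    by (intro sum.cong refl arg_cong2[where f = "(*)"] shift)
  also have "\<dots> = (\<Sum>B\<in>?E. parity_sign B R * of_real (c\<^sup>2))"
  proof (rule sum.cong[OF refl])
    fix B assume "B \<in> ?E"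
    then show "parity_sign B R * ?F B * cnj (?F B) = parity_sign B R * of_real (c\<^sup>2)"
      unfolding mult.assoc complex_norm_square[symmetric] by (simp only: flat)
  qed
  also have "\<dots> = 0"
    using sum_parity_sign[OF X(1,2), of R] R by (simp add: sum_distrib_right[symmetric] even_subsets_def)
  finally have "(\<Sum>S\<in>?E. g (sym_diff S R) * (cnj (g S) + cnj (g (X - S)))) = 0" by simp
  also have "(\<Sum>S\<in>?E. g (sym_diff S R) * (cnj (g S) + cnj (g (X - S))))
      = 2 * (\<Sum>S\<in>?E. g (sym_diff S R) * cnj (g S))"
    using sym by (simp add: sum_distrib_left mult.left_commute)
  finally show ?thesis by simp
qed

lemma not_uniform_mixing_if_odd:
  assumes "m \<ge> 2" "odd m"
  shows "\<not> uniform_mixing_at (folded_halved_cube m) \<tau>"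
proof
  assume mixing: "uniform_mixing_at (folded_halved_cube m) \<tau>"
  have "m \<noteq> 2" using assms(2) by auto
  then have m: "m \<ge> 3" "m \<noteq> 2" using assms(1) by auto
  define X R Y where "X = {..<2 * m}" and "R = {0, 1 :: nat}" and "Y = X - R"
  let ?E = "even_subsets X"
  \<comment> \<open>This is the real part of the summand of the autocorrelation at
    \<open>R\<close>.\<close>
  define \<phi> where "\<phi> S = cos (\<tau> * (folded_eigenvalue m (card S) - folded_eigenvalue m (card (sym_diff S R))))"
    for S :: "nat set"
  have X: "finite X" "X \<noteq> {}" "even (card X)" "card X = 2 * m" "R \<subseteq> X"
    using m by (auto simp: X_def R_def lessThan_empty_iff)
  have R: "R \<in> ?E" "R \<noteq> {}" "R \<noteq> X" "finite R" "card R = 2"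
    using X(4,5) m by (auto simp: R_def even_subsets_def)
  have Y: "finite Y" "card Y = 2 * (m - 1)" "X = Y \<union> R" "Y \<inter> R = {}"
    using X R by (auto simp: Y_def card_Diff_subset)
  have card_le: "card S \<le> 2 * m" "finite S" if "S \<in> ?E" for S
    using that X card_mono[of X S] by (auto simp: even_subsets_def finite_subset)

  have "(\<Sum>S\<in>?E. cis (- \<tau> * folded_eigenvalue m (card (sym_diff S R)))
      * cnj (cis (- \<tau> * folded_eigenvalue m (card S)))) = 0"
  proof (rule autocorrelation_eq_0[OF X(1-3) _ _ R(1-3)])
    \<comment> \<open>Complementation changes only the sign of m - k, and the eigenvalue depends on
      its square.\<close>
    fix S assume S: "S \<in> ?E"
    then have "S \<subseteq> X" by (simp add: even_subsets_def)
    then have "card (X - S) = 2 * m - card S"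
      using card_Diff_subset[OF card_le(2)[OF S], of X] X(4) by simp
    then have "real m - real (card (X - S)) = real (card S) - real m"
      using card_le(1)[OF S] by simp
    then have "folded_eigenvalue m (card (X - S)) = folded_eigenvalue m (card S)"
      unfolding folded_eigenvalue_def by (simp only: power2_commute[of "real (card S)"])
    then show "cis (- \<tau> * folded_eigenvalue m (card (X - S))) = cis (- \<tau> * folded_eigenvalue m (card S))"
      by (simp only:)
  next
    fix B assume "B \<in> ?E"
    then show "norm (\<Sum>S\<in>?E. cis (- \<tau> * folded_eigenvalue m (card S)) * parity_sign S B) = 2 ^ m"
      using mixing uniform_mixing_folded_halved_cube_iff[OF assms(1)] by (simp add: X_def)
  qed
  moreover have "cis (- \<tau> * a) * cnj (cis (- \<tau> * b)) = cis (\<tau> * (b - a))" for a b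
    by (simp add: cis_cnj cis_mult right_diff_distrib)
  ultimately have "Re (\<Sum>S\<in>?E. cis (\<tau> * (folded_eigenvalue m (card S) - folded_eigenvalue m (card (sym_diff S R))))) = 0"
    by (simp only: zero_complex.sel)
  then have sum_0: "(\<Sum>S\<in>?E. \<phi> S) = 0" by (simp add: \<phi>_def)

  \<comment> \<open>The even sets are split by the size of their intersection with \<open>R\<close>:
    \<open>E0\<close> for 0, its translate by \<open>R\<close> for 2, and \<open>E1\<close> for
    1.\<close>
  define E0 E1 where "E0 = even_subsets Y" and "E1 = {S \<in> ?E. card (S \<inter> R) = 1}"
  let ?E2 = "(\<lambda>T. T \<union> R) ` E0"
  have E0: "T \<subseteq> Y" "finite T" "card (T \<union> R) = card T + 2" if "T \<in> E0" for T
    using that Y R by (auto simp: E0_def even_subsets_def finite_subset intro!: card_Un_disjoint[THEN trans])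
  have decomp: "?E = (E0 \<union> ?E2) \<union> E1"
  proof (intro equalityI subsetI)
    fix S assume S: "S \<in> ?E"
    have "S = (S - R) \<union> (S \<inter> R)" by auto
    have card: "card S = card (S - R) + card (S \<inter> R)"
      using card_le(2)[OF S] by (simp add: card_Diff_subset_Int card_mono)
    have "card (S \<inter> R) \<le> 2" using card_mono[of R "S \<inter> R"] R by simp
    then consider "card (S \<inter> R) = 0" | "card (S \<inter> R) = 1" | "card (S \<inter> R) = 2" by linarith
    then show "S \<in> (E0 \<union> ?E2) \<union> E1"
    proof cases
      case 1
      then have "S \<inter> R = {}" using R by simp
      then have "S \<in> E0" using S by (auto simp: E0_def Y_def even_subsets_def)
      then show ?thesis by simp
    next
      case 2
      then show ?thesis using S by (simp add: E1_def)
    next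
      case 3
      then have "S \<inter> R = R" using R card_subset_eq[of R "S \<inter> R"] by simp
      then have "S = (S - R) \<union> R" by auto
      moreover have "S - R \<in> E0" using S card 3 by (auto simp: E0_def Y_def even_subsets_def)
      ultimately show ?thesis by blast
    qed
  next
    fix S assume "S \<in> (E0 \<union> ?E2) \<union> E1"
    then show "S \<in> ?E"
      using E0(3) X(5) by (auto simp: E0_def E1_def Y_def even_subsets_def)
  qed
  have card_Int: "card (T \<inter> R) = 0" "card ((T \<union> R) \<inter> R) = 2" if "T \<in> E0" for T
    using E0(1)[OF that] Y(4) R by (auto simp: Int_absorb1)
  have fin: "finite E0" "finite E1" using X Y by (auto simp: E0_def E1_def)
  have inj: "inj_on (\<lambda>T. T \<union> R) E0"
    using E0(1) Y(4) by (intro inj_onI) blast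
  have "(\<Sum>S\<in>?E. \<phi> S) = (\<Sum>T\<in>E0. \<phi> T) + (\<Sum>T\<in>E0. \<phi> (T \<union> R)) + (\<Sum>S\<in>E1. \<phi> S)"
  proof -
    have "E0 \<inter> ?E2 = {}" "(E0 \<union> ?E2) \<inter> E1 = {}"
      using card_Int by (auto simp: E1_def) force+
    then show ?thesis
      unfolding decomp using fin inj by (simp add: sum.union_disjoint sum.reindex)
  qed
  \<comment> \<open>Translation by \<open>R\<close> removes one element and adds the other, so the
    size and hence the eigenvalue stay the same.\<close>
  moreover have "\<phi> S = 1" if "S \<in> E1" for S
  proof -
    have "card (sym_diff S R) = card S"
      using card_sym_diff[of S R] card_le(2)[of S] that R by (simp add: E1_def)
    then show ?thesis by (simp add: \<phi>_def)
  qed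
  then have "(\<Sum>S\<in>E1. \<phi> S) = card E1" by simp
  \<comment> \<open>An even set containing just one element of \<open>R\<close>; it makes the total
    strictly positive.\<close>
  moreover have "{0, 2} \<in> E1" using m by (auto simp: E1_def X_def R_def even_subsets_def)
  then have "card E1 > 0" using fin by (auto simp: card_gt_0_iff)
  moreover have \<phi>_E0: "\<phi> T = cos (8 * \<tau> * (real (m - 1) - real (card T)))"
    "\<phi> (T \<union> R) = cos (8 * \<tau> * (real (m - 1) - real (card T)))" if T: "T \<in> E0" for T
  proof -
    \<comment> \<open>The difference of squares is linear in \<open>card T\<close> and centred at m
      - 1, half the size of \<open>Y\<close>. Cosine being even, \<open>T\<close> and
      \<open>T \<union> R\<close> contribute the same.\<close>
    have diff: "folded_eigenvalue m (card T) - folded_eigenvalue m (card T + 2)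
        = 8 * (real (m - 1) - real (card T))"
      using m by (simp add: folded_eigenvalue_def power2_eq_square algebra_simps of_nat_diff)
    have sd: "sym_diff T R = T \<union> R" "sym_diff (T \<union> R) R = T" using E0(1)[OF T] Y(4) by auto
    show "\<phi> T = cos (8 * \<tau> * (real (m - 1) - real (card T)))"
      unfolding \<phi>_def sd E0(3)[OF T] diff by (simp add: mult_ac)
    have "folded_eigenvalue m (card T + 2) - folded_eigenvalue m (card T)
        = - (8 * (real (m - 1) - real (card T)))" using diff by linarith
    then show "\<phi> (T \<union> R) = cos (8 * \<tau> * (real (m - 1) - real (card T)))"
      by (simp only: \<phi>_def sd E0(3)[OF T] mult_minus_right cos_minus mult.assoc mult.left_commute[of \<tau>])
  qed
  \<comment> \<open>This is the point where odd m enters: the lemma is applied with n = m - 1, which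
    must be even.\<close>
  have "(\<Sum>T\<in>E0. cos (8 * \<tau> * (real (m - 1) - real (card T)))) \<ge> 0"
    unfolding E0_def using Y assms by (intro sum_cos_even_subsets_nonneg) auto
  ultimately show False
    using sum_0 \<phi>_E0 by simp
qed

theorem theorem7p2:
  fixes m :: nat
  assumes "m \<ge> 2"
  shows "admits_uniform_mixing (folded_halved_cube m) \<longleftrightarrow> even m"
  using admits_uniform_mixing_if_even not_uniform_mixing_if_odd assms
  unfolding admits_uniform_mixing_def by blast

end
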